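(* Let $\Bbbk$ be a field of characteristic $0$, let $n\ge2$, and let $q,q'\in\Bbbk$ be nonzero. Then there is an embedding of Nambu-Poisson fields $N_q\hookrightarrow N_{q'}$ if and only if $q/q'$ is an integer (i.e. lies in $\mathbb Z\subset\Bbbk$).
   Context: A Nambu-Poisson algebra ($n$-Lie Poisson algebra) is a commutative $\Bbbk$-algebra $P$ with an $n$-ary $\Bbbk$-multilinear bracket $\{-,\dots,-\}$ that vanishes whenever two arguments are equal, satisfies $\{\{u_1,\dots,u_n\},v_1,\dots,v_{n-1}\}=\sum_{s=1}^n\{u_1,\dots,u_{s-1},\{u_s,v_1,\dots,v_{n-1}\},u_{s+1},\dots,u_n\}$, and satisfies the Leibniz rule in each argument. An embedding is an injective $\Bbbk$-algebra map preserving brackets. For $q\in\Bbbk^\times$, the $q$-skew Nambu-Poisson field $N_q$ is the rational function field $\Bbbk(t_1,\dots,t_n)$ with the $n$-Lie Poisson bracket determined by $\{t_1,\dots,t_n\}=q\,t_1\cdots t_n$. *)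

theory Defs
  imports
    Complex_Main
    "HOL-Library.Poly_Mapping"
    "HOL-Library.Cardinality"
    "HOL-Computational_Algebra.Fraction_Field"
begin

text \<open>
  The arguments of an n-ary bracket are indexed by a finite linearly ordered type \<open>'n\<close> with
  n = \<open>CARD('n)\<close>: the family \<open>u\<close> stands for the tuple that lists its values in increasing order
  of the index. In the fundamental identity, the family \<open>v(first_index := x)\<close> stands for
  the tuple (x, v_1, ..., v_(n-1)), so the value of \<open>v\<close> at the first index is irrelevant.
\<close>

definition first_index :: "'n::{finite,linorder}" where
  "first_index = Min UNIV"

locale nambu_poisson_algebra = vector_space scale
  for scale :: "'k::field \<Rightarrow> 'p::comm_ring_1 \<Rightarrow> 'p" +
  fixes bracket :: "('n::{finite,linorder} \<Rightarrow> 'p) \<Rightarrow> 'p"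
  assumes scale_mult: "scale c (x * y) = scale c x * y"
    and multilinear: "Vector_Spaces.linear scale scale (\<lambda>x. bracket (u(i := x)))"
    and alternating: "i \<noteq> j \<Longrightarrow> u i = u j \<Longrightarrow> bracket u = 0"
    and fundamental_identity:
      "bracket (v(first_index := bracket u)) = (\<Sum>s\<in>UNIV. bracket (u(s := bracket (v(first_index := u s)))))"
    and leibniz:
      "bracket (u(i := x * y)) = x * bracket (u(i := y)) + bracket (u(i := x)) * y"

locale nambu_poisson_embedding =
  source: nambu_poisson_algebra scale1 bracket1 +
  target: nambu_poisson_algebra scale2 bracket2 +
  Vector_Spaces.linear scale1 scale2 \<phi>
  for scale1 :: "'k::field \<Rightarrow> 'p::comm_ring_1 \<Rightarrow> 'p"
    and bracket1 :: "('n::{finite,linorder} \<Rightarrow> 'p) \<Rightarrow> 'p"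
    and scale2 :: "'k \<Rightarrow> 'r::comm_ring_1 \<Rightarrow> 'r"
    and bracket2 :: "('n \<Rightarrow> 'r) \<Rightarrow> 'r"
    and \<phi> :: "'p \<Rightarrow> 'r" +
  assumes map_one: "\<phi> 1 = 1"
    and map_mult: "\<phi> (x * y) = \<phi> x * \<phi> y"
    and map_bracket: "\<phi> (bracket1 u) = bracket2 (\<lambda>i. \<phi> (u i))"
    and injective: "inj \<phi>"

text \<open>
  Polynomials over \<open>'k\<close> in variables indexed by \<open>'n\<close> are finitely supported maps from exponent
  vectors \<open>'n \<Rightarrow>\<^sub>0 nat\<close> to coefficients; the product of \<open>\<Rightarrow>\<^sub>0\<close> is convolution.
  Rational functions form their fraction field.
\<close>

type_synonym ('k, 'n) ratfun = "(('n \<Rightarrow>\<^sub>0 nat) \<Rightarrow>\<^sub>0 'k) fract"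

definition ratfun_const :: "'k::field \<Rightarrow> ('k, 'n::{finite,linorder}) ratfun" where
  "ratfun_const c = Fract (Poly_Mapping.single 0 c) 1"

definition ratfun_var :: "'n::{finite,linorder} \<Rightarrow> ('k::field, 'n) ratfun" where
  "ratfun_var i = Fract (Poly_Mapping.single (Poly_Mapping.single i 1) 1) 1"

definition ratfun_scale ::
    "'k::field \<Rightarrow> ('k, 'n::{finite,linorder}) ratfun \<Rightarrow> ('k, 'n) ratfun" where
  "ratfun_scale c f = ratfun_const c * f"

text \<open>
  The bracket of N_q: there is exactly one Nambu-Poisson bracket on the
  rational function field with {t_1, ..., t_n} = q t_1 ... t_n, namely q t_1 ... t_n times the
  Jacobian determinant.
\<close>

definition skew_bracket ::
    "'k::field_char_0 \<Rightarrow> ('n::{finite,linorder} \<Rightarrow> ('k, 'n) ratfun) \<Rightarrow> ('k, 'n) ratfun" where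
  "skew_bracket q = (THE br. nambu_poisson_algebra ratfun_scale br \<and>
      br ratfun_var = ratfun_const q * (\<Prod>i\<in>UNIV. ratfun_var i))"

end

theory Submission
  imports Defs "HOL-Analysis.Determinants"
begin

text \<open>
  With the commuting derivations \<open>\<delta>_j = t_j d/dt_j\<close>, the bracket of \<open>N_q\<close> is
  \<open>q det (\<delta>_j u_i)\<close>. A bracket embedding is thus a tuple of nonzero \<open>f_i\<close> with
  \<open>det (\<delta>_j f_i / f_i) = q / q'\<close>. For a monomial order, taking leading terms gives a valuation ring
  with residue field \<open>k\<close>, and each \<open>\<delta>_j f / f\<close> lies in it with residue the \<open>j\<close>-th exponent of the
  leading monomial of \<open>f\<close>. So the constant \<open>q / q'\<close> equals the determinant of an integer matrix.
  Conversely, monomial substitutions realise every nonzero integer.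
\<close>

text \<open>\<open>skew_bracket\<close> is a definite description, so nothing is known about it
  until a bracket with the prescribed value on the variables is shown to exist and to be unique. The
  costly part is existence, namely the fundamental identity for a Jacobian determinant. Fixing all
  arguments but one gives a combination of the \<delta>_j, and the identity holds because the
  divergence of this combination vanishes. The Euler derivations \<delta>_j are preferred to the
  partial derivatives d/dt_j because, while still commuting, they absorb the factor t_1 ... t_n and
  have the monomials as eigenvectors. They therefore never raise a leading monomial, which is why
  every \<delta>_j f / f lies in the valuation ring. Nothing is lost on passing to the residue
  field, since a constant is its own residue.\<close>

section \<open>Derivations and determinants over commutative rings\<close>

definition derivation :: "('a::comm_ring_1 \<Rightarrow> 'a) \<Rightarrow> bool" where
  "derivation d \<longleftrightarrow> (\<forall>x y. d (x + y) = d x + d y) \<and> (\<forall>x y. d (x * y) = d x * y + x * d y)"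

lemma derivationI:
  assumes "\<And>x y. d (x + y) = d x + d y" and "\<And>x y. d (x * y) = d x * y + x * d y"
  shows "derivation d"
  using assms by (simp add: derivation_def)

context
  fixes d :: "'a::comm_ring_1 \<Rightarrow> 'a"
  assumes d: "derivation d"
begin

lemma derivation_add: "d (x + y) = d x + d y"
  using d by (simp add: derivation_def)

lemma derivation_mult: "d (x * y) = d x * y + x * d y"
  using d by (simp add: derivation_def)

lemma derivation_0: "d 0 = 0"
  using derivation_add[of 0 0] by simp

lemma derivation_1: "d 1 = 0"
  using derivation_mult[of 1 1] by simp

lemma derivation_minus: "d (- x) = - d x"
  using derivation_add[of x "- x"] derivation_0 by (simp add: eq_neg_iff_add_eq_0 add.commute)

lemma derivation_diff: "d (x - y) = d x - d y"
  using derivation_add[of x "- y"] derivation_minus[of y] by simp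

lemma derivation_sum: "d (sum f A) = (\<Sum>i\<in>A. d (f i))"
  by (induction A rule: infinite_finite_induct) (simp_all add: derivation_0 derivation_add)

lemma derivation_of_nat: "d (of_nat n) = 0"
  by (induction n) (simp_all add: derivation_0 derivation_1 derivation_add)

lemma derivation_of_int: "d (of_int n) = 0"
  by (cases n rule: int_diff_cases) (simp add: derivation_diff derivation_of_nat)

lemma derivation_prod:
  assumes "finite A"
  shows "d (\<Prod>i\<in>A. f i) = (\<Sum>s\<in>A. \<Prod>i\<in>A. if i = s then d (f i) else f i)"
  using assms
proof (induction A rule: finite_induct)
  case empty
  then show ?case by (simp add: derivation_1)
next
  case (insert x A)
  have "(\<Prod>i\<in>A. if i = x then d (f i) else f i) = (\<Prod>i\<in>A. f i)"
    using insert by (intro prod.cong) auto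
  moreover have "(\<Sum>s\<in>A. \<Prod>i\<in>insert x A. if i = s then d (f i) else f i) =
      f x * (\<Sum>s\<in>A. \<Prod>i\<in>A. if i = s then d (f i) else f i)"
    unfolding sum_distrib_left using insert by (intro sum.cong) auto
  ultimately show ?case
    using insert by (simp add: derivation_mult)
qed

lemma derivation_det:
  "d (det A) = (\<Sum>s\<in>UNIV. det (\<chi> i j. if i = s then d (A $ i $ j) else A $ i $ j))"
  for A :: "'a^'n^'n"
proof -
  have "d (det A) = (\<Sum>p | p permutes (UNIV::'n set). \<Sum>s\<in>UNIV.
      of_int (sign p) * (\<Prod>i\<in>UNIV. if i = s then d (A $ i $ p i) else A $ i $ p i))"
    unfolding det_def derivation_sum derivation_mult derivation_of_int
    by (simp add: derivation_prod sum_distrib_left)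
  also have "\<dots> = (\<Sum>s\<in>UNIV. \<Sum>p | p permutes (UNIV::'n set).
      of_int (sign p) * (\<Prod>i\<in>UNIV. if i = s then d (A $ i $ p i) else A $ i $ p i))"
    by (rule sum.swap)
  finally show ?thesis
    by (simp add: det_def)
qed

end

text \<open>For each permutation \<open>p\<close> both sides mark one factor of the product over
  \<open>i\<close>: the left one by its row, the right one by its column \<open>p i\<close>. As
  \<open>p\<close> is a bijection, summing over \<open>s\<close> marks the same factors.\<close>

lemma sum_det_replace_row_eq_column:
  fixes M N :: "'a::comm_ring_1^'n^'n"
  shows "(\<Sum>s\<in>UNIV. det (\<chi> i j. if i = s then N $ i $ j else M $ i $ j)) =
         (\<Sum>s\<in>UNIV. det (\<chi> i j. if j = s then N $ i $ j else M $ i $ j))"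
proof -
  have "(\<Sum>s\<in>UNIV. \<Prod>i\<in>UNIV. if i = s then N $ i $ p i else M $ i $ p i) =
        (\<Sum>s\<in>UNIV. \<Prod>i\<in>UNIV. if p i = s then N $ i $ p i else M $ i $ p i)"
    if p: "p permutes (UNIV :: 'n set)" for p
  proof -
    have "(\<Sum>s\<in>UNIV. \<Prod>i\<in>UNIV. if p i = s then N $ i $ p i else M $ i $ p i) =
          (\<Sum>s\<in>UNIV. \<Prod>i\<in>UNIV. if p i = p s then N $ i $ p i else M $ i $ p i)"
      by (rule sum.reindex_bij_betw[OF permutes_imp_bij[OF p], symmetric])
    then show ?thesis
      using permutes_inj[OF p] by (simp add: inj_eq)
  qed
  then show ?thesis
    unfolding det_def
    by (subst (1 2) sum.swap) (simp add: sum_distrib_left[symmetric])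
qed

text \<open>Jacobi's formula for the derivative of the determinant at \<open>M\<close> in direction
  \<open>M ** B\<close>. Replacing columns instead of rows puts each summand in the form of Cramer's
  rule, so \<open>M\<close> may be singular.\<close>

lemma sum_det_replace_row_matrix_mult:
  fixes M B :: "'a::field^'n^'n"
  shows "(\<Sum>s\<in>UNIV. det (\<chi> i j. if i = s then (M ** B) $ i $ j else M $ i $ j)) = trace B * det M"
proof -
  have "det (\<chi> i j. if j = s then (M ** B) $ i $ j else M $ i $ j) = B $ s $ s * det M" for s
  proof -
    have "(\<chi> i j. if j = s then (M ** B) $ i $ j else M $ i $ j) =
          (\<chi> i j. if j = s then (M *v column s B) $ i else M $ i $ j)"
      by (simp add: vec_eq_iff matrix_matrix_mult_def matrix_vector_mult_def column_def)
    then show ?thesis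
      using cramer_lemma[where A=M and x="column s B" and k=s] by (simp add: column_def)
  qed
  then show ?thesis
    by (simp add: sum_det_replace_row_eq_column trace_def sum_distrib_right)
qed

text \<open>Laplace expansion. Cofactors are written as full-size determinants with a unit row,
  which avoids minors and the reindexing they require.\<close>

lemma det_expand_row:
  fixes A :: "'n::finite \<Rightarrow> 'n \<Rightarrow> 'a::comm_ring_1"
  shows "det (\<chi> i j. if i = r then w j else A i j) =
    (\<Sum>j\<in>UNIV. w j * det (\<chi> i k. if i = r then of_bool (k = j) else A i k))"
proof -
  have "det (\<chi> i j. if i = r then w j else A i j) =
      det (\<chi> i. if i = r then (\<Sum>j\<in>UNIV. w j *s (\<chi> k. of_bool (k = j))) else (\<chi> k. A i k))"
    by (rule arg_cong[where f=det]) (simp add: vec_eq_iff if_distrib cong: if_cong)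
  also have "\<dots> = (\<Sum>j\<in>UNIV. w j * det (\<chi> i. if i = r then (\<chi> k. of_bool (k = j)) else (\<chi> k. A i k)))"
    by (simp add: det_linear_row_sum det_row_mul)
  also have "\<dots> = (\<Sum>j\<in>UNIV. w j * det (\<chi> i k. if i = r then of_bool (k = j) else A i k))"
    by (intro sum.cong arg_cong2[where f="(*)"] arg_cong[where f=det]) (auto simp: vec_eq_iff)
  finally show ?thesis .
qed

section \<open>The Jacobian bracket of commuting derivations\<close>

locale commuting_derivations =
  fixes \<delta> :: "'n::finite \<Rightarrow> 'a::field_char_0 \<Rightarrow> 'a"
  assumes derivation: "derivation (\<delta> i)"
    and commute: "\<delta> i (\<delta> j x) = \<delta> j (\<delta> i x)"
begin

definition jacobian :: "('n \<Rightarrow> 'a) \<Rightarrow> 'a" where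
  "jacobian u = det (\<chi> i j. \<delta> j (u i))"

text \<open>The cofactor of position (\<open>r\<close>, \<open>j\<close>) in the Jacobian matrix of
  \<open>v\<close>. Row \<open>r\<close> is overwritten, so the value does not depend on
  \<open>v r\<close>; these are the coefficients of the derivation that sends \<open>x\<close> to
  \<open>jacobian (v(r := x))\<close>.\<close>

definition cofactor :: "('n \<Rightarrow> 'a) \<Rightarrow> 'n \<Rightarrow> 'n \<Rightarrow> 'a" where
  "cofactor v r j = det (\<chi> i k. if i = r then of_bool (k = j) else \<delta> k (v i))"

lemma jacobian_upd: "jacobian (v(r := x)) = det (\<chi> i j. if i = r then \<delta> j x else \<delta> j (v i))"
  unfolding jacobian_def by (rule arg_cong[where f=det]) (simp add: vec_eq_iff)

lemma jacobian_expand: "jacobian (v(r := x)) = (\<Sum>j\<in>UNIV. cofactor v r j * \<delta> j x)"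
  unfolding jacobian_upd cofactor_def by (subst det_expand_row) (simp add: mult.commute)

lemma derivation_jacobian: "derivation (\<lambda>x. jacobian (v(r := x)))"
  unfolding jacobian_expand
  by (rule derivationI)
    (simp_all add: derivation_add[OF derivation] derivation_mult[OF derivation] sum.distrib
      sum_distrib_left sum_distrib_right algebra_simps)

lemma jacobian_eq_0:
  assumes "i \<noteq> j" "u i = u j"
  shows "jacobian u = 0"
  unfolding jacobian_def using assms by (intro det_identical_rows[of i j]) (simp_all add: row_def)

text \<open>The Piola identity: the second derivatives are symmetric, while exchanging the two
  unit rows changes the sign.\<close>

lemma divergence_cofactor: "(\<Sum>j\<in>UNIV. \<delta> j (cofactor v r j)) = 0"
proof -
  \<comment> \<open>\<open>T s j k\<close> is the coefficient with which the second derivative of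
    \<open>v s\<close> along \<open>j\<close> and \<open>k\<close> enters: row \<open>s\<close>
    becomes the unit row \<open>k\<close>, and row \<open>r\<close> is already the unit row
    \<open>j\<close>.\<close>
  define T where "T s j k = det (\<chi> i l. if i = s then of_bool (l = k)
      else if i = r then of_bool (l = j) else \<delta> l (v i))" for s j k
  have T_swap: "T s j k = - T s k j" if "s \<noteq> r" for s j k
  proof -
    let ?A = "(\<chi> i l. if i = s then of_bool (l = j)
        else if i = r then of_bool (l = k) else \<delta> l (v i)) :: 'a^'n^'n"
    have "(\<chi> i. ?A $ Transposition.transpose r s i) = (\<chi> i l. if i = s then of_bool (l = k)
        else if i = r then of_bool (l = j) else \<delta> l (v i))"
      using that by (auto simp: vec_eq_iff Transposition.transpose_def)
    then have "T s j k = of_int (sign (Transposition.transpose r s)) * det ?A"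
      unfolding T_def using det_permute_rows[OF permutes_swap_id[of r UNIV s], of ?A] by simp
    then show ?thesis
      using that by (simp add: sign_swap_id T_def)
  qed
  have sum0: "(\<Sum>j\<in>UNIV. \<Sum>k\<in>UNIV. \<delta> j (\<delta> k (v s)) * T s j k) = 0" (is "?S = 0") if "s \<noteq> r" for s
  proof -
    have "?S = (\<Sum>k\<in>UNIV. \<Sum>j\<in>UNIV. \<delta> j (\<delta> k (v s)) * T s j k)"
      by (rule sum.swap)
    \<comment> \<open>A symmetric factor is summed against an antisymmetric one. Characteristic 0
      then turns S = -S into S = 0.\<close>
    also have "\<dots> = - ?S"
      unfolding sum_negf[symmetric]
      by (intro sum.cong refl) (subst T_swap[OF that], subst commute, simp)
    finally show ?thesis by simp
  qed
  have "\<delta> j (cofactor v r j) = (\<Sum>s\<in>UNIV - {r}. \<Sum>k\<in>UNIV. \<delta> j (\<delta> k (v s)) * T s j k)" for j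
  proof -
    let ?C = "(\<chi> i k. if i = r then of_bool (k = j) else \<delta> k (v i)) :: 'a^'n^'n"
    let ?D = "\<lambda>s. det (\<chi> i k. if i = s then \<delta> j (?C $ i $ k) else ?C $ i $ k)"
    \<comment> \<open>Row \<open>r\<close> consists of the constants 0 and 1, so differentiating it
      leaves a zero row.\<close>
    have "?D r = 0"
      by (rule det_zero_row(2)[of r])
        (simp add: row_def vec_eq_iff of_bool_def derivation_0[OF derivation] derivation_1[OF derivation])
    moreover have "?D s = (\<Sum>k\<in>UNIV. \<delta> j (\<delta> k (v s)) * T s j k)" if "s \<noteq> r" for s
    proof -
      have "?D s = det (\<chi> i k. if i = s then \<delta> j (\<delta> k (v s))
          else if i = r then of_bool (k = j) else \<delta> k (v i))"
        using that by (intro arg_cong[where f=det]) (auto simp: vec_eq_iff)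
      then show ?thesis
        unfolding T_def by (subst (asm) det_expand_row)
    qed
    moreover have "\<delta> j (cofactor v r j) = (\<Sum>s\<in>UNIV. ?D s)"
      unfolding cofactor_def by (rule derivation_det[OF derivation])
    ultimately show ?thesis
      by (simp add: sum.remove[of UNIV r])
  qed
  then have "(\<Sum>j\<in>UNIV. \<delta> j (cofactor v r j)) =
      (\<Sum>j\<in>UNIV. \<Sum>s\<in>UNIV - {r}. \<Sum>k\<in>UNIV. \<delta> j (\<delta> k (v s)) * T s j k)"
    by simp
  also have "\<dots> = (\<Sum>s\<in>UNIV - {r}. \<Sum>j\<in>UNIV. \<Sum>k\<in>UNIV. \<delta> j (\<delta> k (v s)) * T s j k)"
    by (rule sum.swap)
  finally show ?thesis
    by (simp add: sum0)
qed

text \<open>Let \<open>D\<close> be the derivation given by bracketing with \<open>v\<close>.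
  Commuting \<open>\<delta> j\<close> past \<open>D\<close> leaves derivatives of its coefficients,
  collected in \<open>B\<close>. So putting \<open>D (u s)\<close> in place of \<open>u s\<close>
  changes row \<open>s\<close> of \<open>M\<close> into \<open>D\<close> of that row plus row
  \<open>s\<close> of \<open>M ** B\<close>. Summed over \<open>s\<close>, the first parts give
  \<open>D (det M)\<close> and the second give \<open>trace B * det M\<close>; the trace of
  \<open>B\<close> is the divergence of \<open>D\<close>, which is 0.\<close>

lemma jacobian_fundamental_identity:
  "jacobian (v(r := jacobian u)) = (\<Sum>s\<in>UNIV. jacobian (u(s := jacobian (v(r := u s)))))"
proof -
  define D where "D x = jacobian (v(r := x))" for x
  define M where "M = (\<chi> i j. \<delta> j (u i))"
  define B where "B = (\<chi> k j. \<delta> j (cofactor v r k))"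
  have D: "derivation D"
    unfolding D_def by (rule derivation_jacobian)
  have comm: "\<delta> j (D x) = D (\<delta> j x) + (\<Sum>k\<in>UNIV. \<delta> k x * \<delta> j (cofactor v r k))" for j x
    unfolding D_def jacobian_expand derivation_sum[OF derivation] derivation_mult[OF derivation]
    by (simp add: sum.distrib commute[of j] algebra_simps)
  have split: "jacobian (u(s := D (u s))) =
      det (\<chi> i j. if i = s then D (M $ i $ j) else M $ i $ j) +
      det (\<chi> i j. if i = s then (M ** B) $ i $ j else M $ i $ j)" for s
  proof -
    have "jacobian (u(s := D (u s))) =
        det (\<chi> i. if i = s then (\<chi> j. D (M $ i $ j)) + (M ** B) $ i else M $ i)"
      unfolding jacobian_upd
      by (rule arg_cong[where f=det]) (simp add: vec_eq_iff comm M_def B_def matrix_matrix_mult_def)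
    also have "\<dots> = det (\<chi> i. if i = s then (\<chi> j. D (M $ i $ j)) else M $ i) +
        det (\<chi> i. if i = s then (M ** B) $ i else M $ i)"
      by (rule det_row_add)
    also have "(\<chi> i. if i = s then (\<chi> j. D (M $ i $ j)) else M $ i) =
        (\<chi> i j. if i = s then D (M $ i $ j) else M $ i $ j)"
      by (simp add: vec_eq_iff)
    also have "(\<chi> i. if i = s then (M ** B) $ i else M $ i) =
        (\<chi> i j. if i = s then (M ** B) $ i $ j else M $ i $ j)"
      by (simp add: vec_eq_iff)
    finally show ?thesis .
  qed
  have "trace B = 0"
    using divergence_cofactor[of v r] by (simp add: trace_def B_def)
  then have "(\<Sum>s\<in>UNIV. jacobian (u(s := D (u s)))) = D (det M)"
    by (simp add: split sum.distrib sum_det_replace_row_matrix_mult derivation_det[OF D])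
  then show ?thesis
    by (simp add: D_def M_def jacobian_def[of u])
qed

end

section \<open>Extension of derivations to fraction fields\<close>

instance fract :: ("{idom,ring_char_0}") field_char_0
proof
  show "inj (of_nat :: nat \<Rightarrow> 'a fract)"
    by (rule injI) (simp add: of_nat_fract eq_fract)
qed

lemma Fract_add_1: "Fract (a + b) 1 = Fract a 1 + Fract b 1"
  by simp

lemma Fract_1_eq_0_iff: "Fract a 1 = 0 \<longleftrightarrow> a = 0"
  by (simp add: Zero_fract_def eq_fract)

text \<open>The quotient rule on a chosen representative. It respects equality of fractions only
  when \<open>d\<close> is a derivation, which is a hypothesis and not part of the type of
  \<open>d\<close>; hence a choice instead of a lifting.\<close>

definition fract_derivation :: "('a::idom \<Rightarrow> 'a) \<Rightarrow> 'a fract \<Rightarrow> 'a fract" where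
  "fract_derivation d x = (let p = (SOME p. snd p \<noteq> 0 \<and> x = Fract (fst p) (snd p))
     in Fract (d (fst p) * snd p - fst p * d (snd p)) (snd p * snd p))"

text \<open>Independence of the representative comes from applying \<open>d\<close> to the
  cross-multiplied equation a * b' = a' * b.\<close>

lemma fract_derivation_Fract:
  assumes d: "derivation d" and "b \<noteq> 0"
  shows "fract_derivation d (Fract a b) = Fract (d a * b - a * d b) (b * b)"
proof -
  define p where "p = (SOME p. snd p \<noteq> 0 \<and> Fract a b = Fract (fst p) (snd p))"
  obtain a' b' where p: "p = (a', b')"
    by (cases p)
  have "snd p \<noteq> 0 \<and> Fract a b = Fract (fst p) (snd p)"
    unfolding p_def by (rule someI[where x="(a, b)"]) (simp add: \<open>b \<noteq> 0\<close>)
  then have b': "b' \<noteq> 0" and eq: "a * b' = a' * b"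
    using \<open>b \<noteq> 0\<close> by (auto simp: p eq_fract)
  have deq: "d a * b' + a * d b' = d a' * b + a' * d b"
    using arg_cong[OF eq, of d] by (simp add: derivation_mult[OF d])
  have "(d a' * b' - a' * d b') * (b * b) = (d a' * b) * (b * b') - (a' * b) * (b * d b')"
    by (simp add: algebra_simps)
  also have "d a' * b = d a * b' + a * d b' - a' * d b"
    using deq by (simp add: algebra_simps)
  also have "(d a * b' + a * d b' - a' * d b) * (b * b') - (a' * b) * (b * d b') =
      d a * b * (b' * b') + a * b' * b * d b' - (a' * b) * (b' * d b) - (a' * b) * (b * d b')"
    by (simp add: algebra_simps)
  also have "\<dots> = (d a * b - a * d b) * (b' * b')"
    unfolding eq[symmetric] by (simp add: algebra_simps)
  finally show ?thesis
    using \<open>b \<noteq> 0\<close> b' by (simp add: fract_derivation_def p_def[symmetric] p eq_fract)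
qed

lemma fract_derivation_of_Fract_1:
  "derivation d \<Longrightarrow> fract_derivation d (Fract a 1) = Fract (d a) 1"
  by (simp add: fract_derivation_Fract derivation_1)

lemma derivation_fract_derivation:
  assumes d: "derivation d"
  shows "derivation (fract_derivation d)"
proof (rule derivationI)
  fix x y :: "'a fract"
  obtain a b c e where x: "x = Fract a b" "b \<noteq> 0" and y: "y = Fract c e" "e \<noteq> 0"
    by (metis Fract_cases)
  show "fract_derivation d (x + y) = fract_derivation d x + fract_derivation d y"
    using x y by (simp add: fract_derivation_Fract[OF d] eq_fract derivation_add[OF d] derivation_mult[OF d])
      (simp add: algebra_simps)
  show "fract_derivation d (x * y) = fract_derivation d x * y + x * fract_derivation d y"
    using x y by (simp add: fract_derivation_Fract[OF d] eq_fract derivation_mult[OF d])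
      (simp add: algebra_simps)
qed

lemma fract_derivation_eq_0I:
  assumes D: "derivation D" and zero: "\<And>a. D (Fract a 1) = 0"
  shows "D x = 0"
proof -
  obtain a b where x: "x = Fract a b" and "b \<noteq> 0"
    by (rule Fract_cases)
  then have "x * Fract b 1 = Fract a 1"
    by (simp add: eq_fract)
  then have "D x * Fract b 1 = 0"
    using derivation_mult[OF D, of x "Fract b 1"] by (simp add: zero)
  then show ?thesis
    using \<open>b \<noteq> 0\<close> by (simp add: Fract_1_eq_0_iff)
qed

section \<open>Euler derivations on polynomials and rational functions\<close>

lemma poly_mapping_sum_single:
  fixes p :: "'a \<Rightarrow>\<^sub>0 'b::comm_monoid_add"
  shows "p = (\<Sum>e\<in>Poly_Mapping.keys p. Poly_Mapping.single e (Poly_Mapping.lookup p e))"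
  by (rule poly_mapping_eqI)
    (simp add: lookup_sum lookup_single when_def in_keys_iff)

lemma poly_mapping_single_induct [case_names single add]:
  fixes p :: "'a \<Rightarrow>\<^sub>0 'b::comm_monoid_add"
  assumes "\<And>e c. P (Poly_Mapping.single e c)" and "\<And>p q. P p \<Longrightarrow> P q \<Longrightarrow> P (p + q)"
  shows "P p"
proof -
  have "P (\<Sum>e\<in>A. Poly_Mapping.single e (Poly_Mapping.lookup p e))" if "finite A" for A
    using that
  proof (induction A rule: finite_induct)
    case empty
    then show ?case using assms(1)[of _ 0] by simp
  qed (simp add: assms)
  then show ?thesis
    by (subst poly_mapping_sum_single[of p]) simp
qed

type_synonym ('k, 'n) polynomial = "('n \<Rightarrow>\<^sub>0 nat) \<Rightarrow>\<^sub>0 'k"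

text \<open>The operator t_i d/dt_i. It rescales coefficients and leaves exponents alone, so no
  exponent ever has to be decreased.\<close>

definition euler :: "'n \<Rightarrow> ('k::field, 'n) polynomial \<Rightarrow> ('k, 'n) polynomial" where
  "euler i = Poly_Mapping.mapp (\<lambda>e c. of_nat (Poly_Mapping.lookup e i) * c)"

lemma lookup_euler:
  "Poly_Mapping.lookup (euler i p) e = of_nat (Poly_Mapping.lookup e i) * Poly_Mapping.lookup p e"
  by (simp add: euler_def lookup_mapp when_def in_keys_iff)

lemma euler_single:
  "euler i (Poly_Mapping.single e c) = Poly_Mapping.single e (of_nat (Poly_Mapping.lookup e i) * c)"
  by (rule poly_mapping_eqI) (simp add: lookup_euler lookup_single when_def)

lemma euler_add: "euler i (p + q) = euler i p + euler i q"
  by (rule poly_mapping_eqI) (simp add: lookup_euler lookup_add algebra_simps)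

lemma derivation_euler: "derivation (euler i :: ('k::field, 'n) polynomial \<Rightarrow> _)"
proof (rule derivationI)
  fix p q :: "('k, 'n) polynomial"
  show "euler i (p + q) = euler i p + euler i q"
    by (rule euler_add)
  show "euler i (p * q) = euler i p * q + p * euler i q"
  proof (induction p rule: poly_mapping_single_induct)
    case (single e c)
    show ?case
      by (induction q rule: poly_mapping_single_induct)
        (simp_all add: mult_single euler_single euler_add lookup_add single_add[symmetric] algebra_simps)
  qed (simp add: euler_add algebra_simps)
qed

definition log_derivation ::
    "'n::{finite,linorder} \<Rightarrow> ('k::field_char_0, 'n) ratfun \<Rightarrow> ('k, 'n) ratfun" where
  "log_derivation i = fract_derivation (euler i)"

lemma derivation_log_derivation: "derivation (log_derivation i)"
  unfolding log_derivation_def by (intro derivation_fract_derivation derivation_euler)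

lemma log_derivation_Fract_1: "log_derivation i (Fract p 1) = Fract (euler i p) 1"
  unfolding log_derivation_def by (rule fract_derivation_of_Fract_1[OF derivation_euler])

lemma log_derivation_const [simp]: "log_derivation i (ratfun_const c) = 0"
  by (simp add: ratfun_const_def log_derivation_Fract_1 euler_single fract_collapse)

lemma log_derivation_var [simp]:
  "log_derivation i (ratfun_var j) = (if i = j then ratfun_var j else 0)"
  by (simp add: ratfun_var_def log_derivation_Fract_1 euler_single fract_collapse lookup_single)

lemma ratfun_const_1: "ratfun_const 1 = 1"
  by (simp add: ratfun_const_def One_fract_def)

lemma ratfun_const_add: "ratfun_const (c + d) = ratfun_const c + ratfun_const d"
  by (simp add: ratfun_const_def single_add)

lemma ratfun_const_mult: "ratfun_const (c * d) = ratfun_const c * ratfun_const d"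
  by (simp add: ratfun_const_def mult_single)

lemma ratfun_const_eq_iff [simp]: "(ratfun_const c :: ('k::field, 'n::{finite,linorder}) ratfun) = ratfun_const d \<longleftrightarrow> c = d"
proof -
  have "(Poly_Mapping.single 0 c :: ('k, 'n) polynomial) = Poly_Mapping.single 0 d \<longleftrightarrow> c = d"
    by (metis lookup_single_eq)
  then show ?thesis by (simp add: ratfun_const_def eq_fract)
qed

lemma ratfun_const_0: "ratfun_const 0 = 0"
  by (simp add: ratfun_const_def fract_collapse)

lemma ratfun_const_diff: "ratfun_const (c - d) = ratfun_const c - ratfun_const d"
  by (simp add: eq_diff_eq ratfun_const_add[symmetric])

lemma ratfun_const_of_nat: "ratfun_const (of_nat n) = of_nat n"
  by (induction n) (simp_all add: ratfun_const_0 ratfun_const_1 ratfun_const_add)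

lemma ratfun_const_of_int: "ratfun_const (of_int z) = of_int z"
  by (cases z rule: int_diff_cases) (simp add: ratfun_const_diff ratfun_const_of_nat)

lemma ratfun_var_neq_0 [simp]: "ratfun_var i \<noteq> (0 :: ('k::field, 'n::{finite,linorder}) ratfun)"
proof -
  have "Poly_Mapping.single (Poly_Mapping.single i 1) 1 \<noteq> (0 :: ('k, 'n) polynomial)"
    by (metis lookup_single_eq lookup_zero zero_neq_one)
  then show ?thesis by (simp add: ratfun_var_def Zero_fract_def eq_fract)
qed

text \<open>Reduces an identity between derivations that agree on constants to a check on the
  variables.\<close>

lemma ratfun_derivation_eq_0I:
  fixes D :: "('k::field, 'n::{finite,linorder}) ratfun \<Rightarrow> ('k, 'n) ratfun"
  assumes D: "derivation D"
    and const: "\<And>c. D (ratfun_const c) = 0" and var: "\<And>i. D (ratfun_var i) = 0"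
  shows "D x = 0"
proof (rule fract_derivation_eq_0I[OF D])
  fix p :: "('k, 'n) polynomial"
  show "D (Fract p 1) = 0"
  proof (induction p rule: poly_mapping_single_induct)
    case (single e c)
    show ?case
    \<comment> \<open>Exponent vectors are finitely supported maps too, so the same induction splits
      a monomial into powers of single variables. The coefficient stays arbitrary because one of the
      two factors receives coefficient 1.\<close>
    proof (induction e arbitrary: c rule: poly_mapping_single_induct)
      case (single i k)
      show ?case
      proof (induction k)
        case 0
        then show ?case using const[of c] by (simp add: ratfun_const_def)
      next
        case (Suc k)
        have "Fract (Poly_Mapping.single (Poly_Mapping.single i (Suc k)) c) 1 =
            Fract (Poly_Mapping.single (Poly_Mapping.single i k) c) 1 * ratfun_var i"
          by (simp add: ratfun_var_def mult_single single_add[symmetric])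
        then show ?case
          by (simp add: derivation_mult[OF D] Suc var)
      qed
    next
      case (add e f)
      have "Fract (Poly_Mapping.single (e + f) c) 1 =
          Fract (Poly_Mapping.single e c) 1 * Fract (Poly_Mapping.single f 1) 1"
        by (simp add: mult_single)
      then show ?case
        by (simp only: derivation_mult[OF D] add) simp
    qed
  next
    case (add p q)
    then show ?case
      using derivation_add[OF D] by (simp add: Fract_add_1 del: add_fract)
  qed
qed

text \<open>The chain rule: \<open>log_derivation j x / ratfun_var j\<close> is the ordinary partial
  derivative. The difference of both sides is a derivation that vanishes on constants and
  variables.\<close>

lemma ratfun_derivation_expand:
  fixes D :: "('k::field_char_0, 'n::{finite,linorder}) ratfun \<Rightarrow> ('k, 'n) ratfun"
  assumes D: "derivation D" and const: "\<And>c. D (ratfun_const c) = 0"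
  shows "D x = (\<Sum>j\<in>UNIV. log_derivation j x / ratfun_var j * D (ratfun_var j))"
proof -
  let ?E = "\<lambda>x. D x - (\<Sum>j\<in>UNIV. log_derivation j x / ratfun_var j * D (ratfun_var j))"
  have "?E x = 0"
  proof (rule ratfun_derivation_eq_0I[where D="?E"])
    show "derivation ?E"
      by (rule derivationI)
        (simp_all add: derivation_add[OF D] derivation_mult[OF D]
          derivation_add[OF derivation_log_derivation] derivation_mult[OF derivation_log_derivation]
          add_divide_distrib algebra_simps sum.distrib sum_distrib_left)
    show "?E (ratfun_const c) = 0" for c
      by (simp add: const)
    show "?E (ratfun_var i) = 0" for i
      by (simp add: if_distrib[of "\<lambda>x. x / _"] if_distrib[of "\<lambda>x. x * _"] cong: if_cong)
  qed
  then show ?thesis by simp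
qed

text \<open>A composition of derivations is in general not a derivation, but a commutator is, so
  commutation can be tested on constants and variables.\<close>

interpretation ratfun: commuting_derivations
  "log_derivation :: 'n::{finite,linorder} \<Rightarrow> ('k::field_char_0, 'n) ratfun \<Rightarrow> _"
proof
  show "derivation (log_derivation i)" for i
    by (rule derivation_log_derivation)
  fix i j and x :: "('k, 'n) ratfun"
  let ?E = "\<lambda>x::('k, 'n) ratfun. log_derivation i (log_derivation j x) - log_derivation j (log_derivation i x)"
  have "?E x = 0"
  proof (rule ratfun_derivation_eq_0I[where D="?E"])
    show "derivation ?E"
      by (rule derivationI)
        (simp_all add: derivation_add[OF derivation_log_derivation]
          derivation_mult[OF derivation_log_derivation] algebra_simps)
  qed (auto simp: derivation_0[OF derivation_log_derivation])
  then show "log_derivation i (log_derivation j x) = log_derivation j (log_derivation i x)"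
    by simp
qed

section \<open>Uniqueness of the bracket with given value on the variables\<close>

context nambu_poisson_algebra
begin

lemma bracket_add: "bracket (u(i := x + y)) = bracket (u(i := x)) + bracket (u(i := y))"
  using multilinear[of u i]
  by (simp add: Vector_Spaces.linear_def module_hom_def module_hom_axioms_def)

lemma bracket_scale: "bracket (u(i := scale c x)) = scale c (bracket (u(i := x)))"
  using multilinear[of u i]
  by (simp add: Vector_Spaces.linear_def module_hom_def module_hom_axioms_def)

lemma bracket_swap:
  assumes "i \<noteq> j"
  shows "bracket (u(i := u j, j := u i)) = - bracket u"
proof -
  let ?b = "\<lambda>x y. bracket (u(i := x, j := y))"
  have 0: "?b x x = 0" for x
    using assms by (intro alternating[of i j]) auto
  have add2: "?b x (y + z) = ?b x y + ?b x z" for x y z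
    by (rule bracket_add)
  have add1: "?b (x + y) z = ?b x z + ?b y z" for x y z
    using bracket_add[of "u(j := z)" i x y] assms by (simp add: fun_upd_twist)
  have "0 = ?b (u i + u j) (u i + u j)"
    by (simp add: 0)
  also have "\<dots> = ?b (u i) (u j) + ?b (u j) (u i)"
    unfolding add1 add2 by (simp only: 0 add_0_left add_0_right add.commute)
  finally show ?thesis
    by (metis fun_upd_triv add.commute eq_neg_iff_add_eq_0)
qed

lemma derivation_bracket: "derivation (\<lambda>x. bracket (u(i := x)))"
  by (rule derivationI) (simp_all add: bracket_add leibniz)

lemma bracket_scale_1: "bracket (u(i := scale c 1)) = 0"
  by (simp only: bracket_scale derivation_1[OF derivation_bracket] scale_zero_right)

lemma bracket_permutes:
  assumes "p permutes UNIV"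
  shows "bracket (\<lambda>i. u (p i)) = of_int (sign p) * bracket u"
  using finite assms
proof (induction p arbitrary: u rule: permutes_rev_induct)
  case id
  then show ?case by simp
next
  case (swap a b p)
  show ?case
  proof (cases "a = b")
    case False
    let ?v = "\<lambda>i. u (p i)"
    have "(\<lambda>i. u ((p \<circ> Transposition.transpose a b) i)) = ?v(a := ?v b, b := ?v a)"
      by (auto simp: fun_eq_iff Transposition.transpose_def)
    then have "bracket (\<lambda>i. u ((p \<circ> Transposition.transpose a b) i)) = - bracket ?v"
      by (simp only: bracket_swap[OF False, of ?v])
    moreover have "sign (p \<circ> Transposition.transpose a b) = - sign p"
      using False swap.hyps
      by (simp add: sign_compose permutation_swap_id permutes_imp_permutation[of UNIV] sign_swap_id)
    ultimately show ?thesis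
      using swap.IH[of u] by (simp del: o_apply)
  qed (use swap in simp)
qed

end

text \<open>Each argument acts as a derivation, so it may be expanded into variables; a bracket of
  variables is, up to sign, either zero or the bracket of all variables.\<close>

lemma ratfun_bracket_unique:
  fixes br1 br2 :: "('n::{finite,linorder} \<Rightarrow> ('k::field_char_0, 'n) ratfun) \<Rightarrow> ('k, 'n) ratfun"
  assumes 1: "nambu_poisson_algebra ratfun_scale br1" and 2: "nambu_poisson_algebra ratfun_scale br2"
    and var: "br1 ratfun_var = br2 ratfun_var"
  shows "br1 = br2"
proof
  have expand: "br u = (\<Sum>j\<in>UNIV. log_derivation j (u i) / ratfun_var j * br (u(i := ratfun_var j)))"
    if "nambu_poisson_algebra ratfun_scale br"
    for br :: "('n \<Rightarrow> ('k, 'n) ratfun) \<Rightarrow> ('k, 'n) ratfun" and u i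
  proof -
    interpret nambu_poisson_algebra ratfun_scale br by fact
    show ?thesis
      using ratfun_derivation_expand[OF derivation_bracket, of u i "u i"] bracket_scale_1[of u i]
      by (simp add: ratfun_scale_def)
  qed
  \<comment> \<open>\<open>S\<close> contains the positions that may still hold an arbitrary
    function. Expanding one of them into variables removes it from \<open>S\<close>.\<close>
  have "br1 u = br2 u" if "finite S" "\<And>i. i \<notin> S \<Longrightarrow> u i \<in> range ratfun_var" for S u
    using that
  proof (induction S arbitrary: u rule: finite_induct)
    case empty
    then have "\<forall>i. \<exists>j. u i = ratfun_var j"
      by auto
    then obtain f where f: "\<And>i. u i = ratfun_var (f i)"
      by metis
    then have u: "u = (\<lambda>i. ratfun_var (f i))"
      by auto
    show ?case
    proof (cases "inj f")
      case True
      then have "f permutes UNIV"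
        by (intro bij_imp_permutes) (simp_all add: bij_def finite_UNIV_inj_surj)
      then show ?thesis
        unfolding u using nambu_poisson_algebra.bracket_permutes[OF 1]
          nambu_poisson_algebra.bracket_permutes[OF 2] var by metis
    next
      case False
      then obtain i j where "i \<noteq> j" "u i = u j"
        by (auto simp: inj_def f)
      then show ?thesis
        using nambu_poisson_algebra.alternating[OF 1] nambu_poisson_algebra.alternating[OF 2]
        by metis
    qed
  next
    case (insert i S)
    have "br1 (u(i := ratfun_var j)) = br2 (u(i := ratfun_var j))" for j
      using insert.prems by (intro insert.IH) auto
    then show ?case
      unfolding expand[OF 1, of u i] expand[OF 2, of u i] by simp
  qed
  from this[of UNIV] show "br1 u = br2 u" for u
    by simp
qed

section \<open>Existence of the bracket and the formula for \<open>skew_bracket\<close>\<close>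

lemma vector_space_ratfun_scale:
  "vector_space (ratfun_scale :: 'k::field_char_0 \<Rightarrow> ('k, 'n::{finite,linorder}) ratfun \<Rightarrow> _)"
  by standard
    (simp_all add: ratfun_scale_def ratfun_const_add ratfun_const_mult ratfun_const_1 algebra_simps)

lemma nambu_poisson_algebra_jacobian:
  "nambu_poisson_algebra ratfun_scale
    (\<lambda>u :: 'n::{finite,linorder} \<Rightarrow> ('k::field_char_0, 'n) ratfun. ratfun_const q * ratfun.jacobian u)"
proof -
  interpret vector_space "ratfun_scale :: 'k \<Rightarrow> ('k, 'n) ratfun \<Rightarrow> _"
    by (rule vector_space_ratfun_scale)
  have const: "ratfun.jacobian (u(i := ratfun_const c * x)) = ratfun_const c * ratfun.jacobian (u(i := x))"
    for u :: "'n \<Rightarrow> ('k, 'n) ratfun" and i c x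
    by (simp add: ratfun.jacobian_expand derivation_mult[OF derivation_log_derivation]
        sum_distrib_left mult_ac)
  show ?thesis
  proof (intro nambu_poisson_algebra.intro nambu_poisson_algebra_axioms.intro vector_space_ratfun_scale)
    fix u v :: "'n \<Rightarrow> ('k, 'n) ratfun" and i
    show "Vector_Spaces.linear ratfun_scale ratfun_scale
        (\<lambda>x. ratfun_const q * ratfun.jacobian (u(i := x)))"
      by unfold_locales
        (simp_all add: ratfun_scale_def const derivation_add[OF ratfun.derivation_jacobian] distrib_left mult.left_commute)
    show "ratfun_const q * ratfun.jacobian (u(i := x * y)) =
        x * (ratfun_const q * ratfun.jacobian (u(i := y))) +
        ratfun_const q * ratfun.jacobian (u(i := x)) * y" for x y
      by (simp add: derivation_mult[OF ratfun.derivation_jacobian] algebra_simps)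
    show "ratfun_const q * ratfun.jacobian
          (v(first_index := ratfun_const q * ratfun.jacobian u)) =
        (\<Sum>s\<in>UNIV. ratfun_const q * ratfun.jacobian
          (u(s := ratfun_const q * ratfun.jacobian (v(first_index := u s)))))"
      \<comment> \<open>The identity is quadratic in the bracket, so both sides carry the factor
        \<open>q\<close> twice.\<close>
      by (subst const, subst ratfun.jacobian_fundamental_identity) (simp add: const sum_distrib_left)
  qed (auto simp: ratfun_scale_def ratfun.jacobian_eq_0)
qed

text \<open>The matrix is diagonal with entries t_i. This accounts for the factor t_1 ... t_n in the
  normalisation of N_q.\<close>

lemma jacobian_ratfun_var: "ratfun.jacobian ratfun_var = (\<Prod>i\<in>UNIV. ratfun_var i)"
  unfolding ratfun.jacobian_def by (subst det_diagonal) simp_all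

lemma skew_bracket_eq: "skew_bracket q = (\<lambda>u. ratfun_const q * ratfun.jacobian u)"
  unfolding skew_bracket_def
proof (rule the_equality)
  show "nambu_poisson_algebra ratfun_scale (\<lambda>u. ratfun_const q * ratfun.jacobian u) \<and>
      ratfun_const q * ratfun.jacobian ratfun_var = ratfun_const q * (\<Prod>i\<in>UNIV. ratfun_var i)"
    by (simp add: nambu_poisson_algebra_jacobian jacobian_ratfun_var)
qed (auto intro!: ratfun_bracket_unique nambu_poisson_algebra_jacobian simp: jacobian_ratfun_var)

section \<open>Embeddings of integral domains and of their fraction fields\<close>

definition fract_map :: "('a::idom \<Rightarrow> 'b::idom) \<Rightarrow> 'a fract \<Rightarrow> 'b fract" where
  "fract_map h x = (let p = (SOME p. snd p \<noteq> 0 \<and> x = Fract (fst p) (snd p))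
     in Fract (h (fst p)) (h (snd p)))"

text \<open>Injectivity keeps denominators nonzero, which is what lets \<open>h\<close> extend to
  fractions.\<close>

locale idom_embedding =
  fixes h :: "'a::idom \<Rightarrow> 'b::idom"
  assumes add: "h (x + y) = h x + h y" and mult: "h (x * y) = h x * h y"
    and one: "h 1 = 1" and inj: "inj h"
begin

lemma zero: "h 0 = 0"
  using add[of 0 0] unfolding add_0_left add_cancel_right_right .

lemma eq_0_iff [simp]: "h x = 0 \<longleftrightarrow> x = 0"
  using inj zero by (metis inj_eq)

lemma fract_map_Fract:
  assumes "b \<noteq> 0"
  shows "fract_map h (Fract a b) = Fract (h a) (h b)"
proof -
  define p where "p = (SOME p. snd p \<noteq> 0 \<and> Fract a b = Fract (fst p) (snd p))"
  have "snd p \<noteq> 0 \<and> Fract a b = Fract (fst p) (snd p)"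
    unfolding p_def by (rule someI[where x="(a, b)"]) (simp add: \<open>b \<noteq> 0\<close>)
  then have p: "snd p \<noteq> 0" and "a * snd p = fst p * b"
    using \<open>b \<noteq> 0\<close> by (auto simp: eq_fract)
  then have "h a * h (snd p) = h (fst p) * h b"
    by (metis mult)
  then show ?thesis
    using \<open>b \<noteq> 0\<close> p by (simp add: fract_map_def p_def[symmetric] eq_fract)
qed

lemma fract_map_embedding: "idom_embedding (fract_map h)"
proof
  fix x y :: "'a fract"
  obtain a b c d where x: "x = Fract a b" "b \<noteq> 0" and y: "y = Fract c d" "d \<noteq> 0"
    by (metis Fract_cases)
  show "fract_map h (x + y) = fract_map h x + fract_map h y"
    using x y by (simp add: fract_map_Fract add mult)
  show "fract_map h (x * y) = fract_map h x * fract_map h y"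
    using x y by (simp add: fract_map_Fract mult)
next
  show "fract_map h 1 = 1"
    by (simp add: One_fract_def fract_map_Fract one)
  show "inj (fract_map h)"
  proof (rule injI)
    fix x y :: "'a fract"
    assume eq: "fract_map h x = fract_map h y"
    obtain a b c d where x: "x = Fract a b" "b \<noteq> 0" and y: "y = Fract c d" "d \<noteq> 0"
      by (metis Fract_cases)
    then have "h (a * d) = h (c * b)"
      using eq by (simp add: fract_map_Fract eq_fract mult)
    then show "x = y"
      using x y inj by (simp add: eq_fract inj_eq)
  qed
qed

lemma sum: "h (sum f A) = (\<Sum>i\<in>A. h (f i))"
  by (induction A rule: infinite_finite_induct) (simp_all add: zero add)

lemma prod: "h (prod f A) = (\<Prod>i\<in>A. h (f i))"
  by (induction A rule: infinite_finite_induct) (simp_all add: one mult)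

lemma minus: "h (- x) = - h x"
  using add[of x "- x"] zero by (simp add: eq_neg_iff_add_eq_0 add.commute)

lemma det: "h (det A) = det (\<chi> i j. h (A $ i $ j))" for A :: "'a^'n^'n"
proof -
  have "h (of_int (sign p)) = of_int (sign p)" for p :: "'n \<Rightarrow> 'n"
    by (simp add: sign_def minus one)
  then show ?thesis
    by (simp add: det_def sum prod mult)
qed

end

section \<open>Monomial substitutions and the integers they realise\<close>

text \<open>For injective \<open>A\<close>, the map of monoid algebras that sends the monomial with
  exponent e to the one with exponent \<open>A e\<close>. Injectivity allows coefficients to be read
  off through \<open>inv A\<close>, with no summation over fibres.\<close>

lift_definition map_exponents :: "('a \<Rightarrow> 'b) \<Rightarrow> ('a \<Rightarrow>\<^sub>0 'c::zero) \<Rightarrow> 'b \<Rightarrow>\<^sub>0 'c"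
  is "\<lambda>A p e. if e \<in> range A then p (inv A e) else 0"
proof -
  fix A :: "'a \<Rightarrow> 'b" and p :: "'a \<Rightarrow> 'c"
  assume "finite {k. p k \<noteq> 0}"
  moreover have "{e. (if e \<in> range A then p (inv A e) else 0) \<noteq> 0} \<subseteq> A ` {k. p k \<noteq> 0}"
    by (auto split: if_splits) (metis (mono_tags, lifting) f_inv_into_f image_eqI mem_Collect_eq rangeI)
  ultimately show "finite {e. (if e \<in> range A then p (inv A e) else 0) \<noteq> 0}"
    by (rule finite_surj)
qed

lemma map_exponents_add:
  "map_exponents A (p + q) = map_exponents A p + map_exponents A q"
  by (rule poly_mapping_eqI) (simp add: map_exponents.rep_eq lookup_add)

lemma map_exponents_single:
  assumes "inj A"
  shows "map_exponents A (Poly_Mapping.single e c) = Poly_Mapping.single (A e) c"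
proof (rule poly_mapping_eqI)
  fix f
  show "Poly_Mapping.lookup (map_exponents A (Poly_Mapping.single e c)) f =
      Poly_Mapping.lookup (Poly_Mapping.single (A e) c) f"
  proof (cases "f \<in> range A")
    case True
    then obtain g where "f = A g"
      by blast
    then show ?thesis
      by (simp add: map_exponents.rep_eq lookup_single when_def inj_eq[OF assms] inv_f_f[OF assms])
  next
    case False
    then have "A e \<noteq> f"
      by blast
    with False show ?thesis
      by (simp add: map_exponents.rep_eq lookup_single when_def)
  qed
qed

lemma map_exponents_embedding:
  fixes A :: "'a::{ordered_cancel_comm_monoid_add,linorder} \<Rightarrow> 'b::{ordered_cancel_comm_monoid_add,linorder}"
  assumes inj: "inj A" and add: "\<And>x y. A (x + y) = A x + A y"
  shows "idom_embedding (map_exponents A :: ('a \<Rightarrow>\<^sub>0 'k::idom) \<Rightarrow> _)"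
proof
  have "A 0 = 0"
    using add[of 0 0] add_left_imp_eq[of "A 0" "A 0" 0] by (metis add_0_left add_0_right)
  then show "map_exponents A (1 :: 'a \<Rightarrow>\<^sub>0 'k) = 1"
    unfolding single_one[symmetric] by (simp only: map_exponents_single[OF inj])
  show "inj (map_exponents A :: ('a \<Rightarrow>\<^sub>0 'k) \<Rightarrow> _)"
  proof (rule injI, rule poly_mapping_eqI)
    fix p q :: "'a \<Rightarrow>\<^sub>0 'k" and e
    assume "map_exponents A p = map_exponents A q"
    then show "Poly_Mapping.lookup p e = Poly_Mapping.lookup q e"
      using inj by (metis inv_f_f map_exponents.rep_eq rangeI)
  qed
  fix p q :: "'a \<Rightarrow>\<^sub>0 'k"
  show "map_exponents A (p + q) = map_exponents A p + map_exponents A q"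
    by (rule map_exponents_add)
  show "map_exponents A (p * q) = map_exponents A p * map_exponents A q"
  proof (induction p rule: poly_mapping_single_induct)
    case (single e c)
    show ?case
      by (induction q rule: poly_mapping_single_induct)
        (simp_all add: mult_single map_exponents_single[OF inj] map_exponents_add add algebra_simps)
  qed (simp add: map_exponents_add algebra_simps)
qed

text \<open>The substitution sending the variable with index \<open>\<sigma> i\<close> to the power \<open>m i\<close> of the variable with
  index \<open>i\<close>. Odd permutations provide the negative integers without negative exponents.\<close>

definition exponent_map :: "('n::finite \<Rightarrow> nat) \<Rightarrow> ('n \<Rightarrow> 'n) \<Rightarrow> ('n \<Rightarrow>\<^sub>0 nat) \<Rightarrow> ('n \<Rightarrow>\<^sub>0 nat)" where
  "exponent_map m \<sigma> e = Abs_poly_mapping (\<lambda>i. m i * Poly_Mapping.lookup e (\<sigma> i))"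

lemma lookup_exponent_map:
  "Poly_Mapping.lookup (exponent_map m \<sigma> e) i = m i * Poly_Mapping.lookup e (\<sigma> i)"
  by (simp add: exponent_map_def)

lemma exponent_map_add: "exponent_map m \<sigma> (e + f) = exponent_map m \<sigma> e + exponent_map m \<sigma> f"
  by (rule poly_mapping_eqI) (simp add: lookup_exponent_map lookup_add algebra_simps)

lemma inj_exponent_map:
  assumes "\<And>i. m i \<noteq> 0" and "surj \<sigma>"
  shows "inj (exponent_map m \<sigma>)"
proof (rule injI, rule poly_mapping_eqI)
  fix e f i
  assume eq: "exponent_map m \<sigma> e = exponent_map m \<sigma> f"
  obtain j where "i = \<sigma> j"
    using assms(2) by (metis surjD)
  then show "Poly_Mapping.lookup e i = Poly_Mapping.lookup f i"
    using arg_cong[OF eq, of "\<lambda>e. Poly_Mapping.lookup e j"] assms(1)[of j]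
    by (simp add: lookup_exponent_map)
qed

text \<open>The chain rule on eigenvectors: the \<open>i\<close>-th exponent of an image monomial is
  \<open>m i\<close> times the \<open>\<sigma> i\<close>-th exponent of the original.\<close>

lemma euler_map_exponents:
  assumes "inj (exponent_map m \<sigma>)"
  shows "euler i (map_exponents (exponent_map m \<sigma>) p) =
    Poly_Mapping.single 0 (of_nat (m i)) * map_exponents (exponent_map m \<sigma>) (euler (\<sigma> i) p)"
proof (induction p rule: poly_mapping_single_induct)
  case (single e c)
  show ?case
    by (simp add: euler_single map_exponents_single[OF assms] lookup_exponent_map mult_single mult.assoc
        del: single_of_nat)
qed (simp add: map_exponents_add euler_add algebra_simps)

text \<open>The substitution multiplies the matrix of Euler derivatives by a permutation matrix with
  weights \<open>m i\<close>, whose determinant is the integer in the statement. That factor is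
  moved to the source bracket.\<close>

lemma nambu_poisson_embedding_monomial:
  fixes q :: "'k::field_char_0" and m :: "'n::{finite,linorder} \<Rightarrow> nat" and \<sigma> :: "'n \<Rightarrow> 'n"
  assumes m: "\<And>i. m i \<noteq> 0" and \<sigma>: "\<sigma> permutes UNIV"
  shows "\<exists>\<phi> :: ('k, 'n) ratfun \<Rightarrow> ('k, 'n) ratfun. nambu_poisson_embedding ratfun_scale
    (skew_bracket (q * of_int (sign \<sigma> * (\<Prod>i\<in>UNIV. int (m i))))) ratfun_scale (skew_bracket q) \<phi>"
proof -
  let ?A = "exponent_map m \<sigma>"
  define h where "h = (map_exponents ?A :: ('k, 'n) polynomial \<Rightarrow> ('k, 'n) polynomial)"
  have A: "inj ?A"
    by (rule inj_exponent_map[OF m permutes_surj[OF \<sigma>]])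
  interpret h: idom_embedding h
    unfolding h_def by (rule map_exponents_embedding[OF A exponent_map_add])
  define \<phi> where "\<phi> = fract_map h"
  interpret \<phi>: idom_embedding \<phi>
    unfolding \<phi>_def by (rule h.fract_map_embedding)
  have A0: "?A 0 = 0"
    using exponent_map_add[of m \<sigma> 0 0] by simp
  have const: "\<phi> (ratfun_const c) = ratfun_const c" for c
    by (simp add: \<phi>_def ratfun_const_def h.fract_map_Fract h.one)
      (simp add: h_def map_exponents_single[OF A] A0)
  have log: "log_derivation i (\<phi> x) = ratfun_const (of_nat (m i)) * \<phi> (log_derivation (\<sigma> i) x)" for i x
  proof -
    obtain a b where x: "x = Fract a b" and b: "b \<noteq> 0"
      by (rule Fract_cases)
    have h: "euler i (h p) = Poly_Mapping.single 0 (of_nat (m i)) * h (euler (\<sigma> i) p)" for p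
      unfolding h_def by (rule euler_map_exponents[OF A])
    have hdiff: "h (p - r) = h p - h r" for p r
      using h.add[of p "- r"] by (simp add: h.minus)
    show ?thesis
      using b by (simp add: x log_derivation_def \<phi>_def h.fract_map_Fract ratfun_const_def
          fract_derivation_Fract[OF derivation_euler] h hdiff h.mult algebra_simps)
  qed
  have jacobian: "ratfun.jacobian (\<lambda>i. \<phi> (u i)) =
      ratfun_const (of_int (sign \<sigma> * (\<Prod>i\<in>UNIV. int (m i)))) * \<phi> (ratfun.jacobian u)" for u
  proof -
    \<comment> \<open>The derivations index columns of the Jacobian matrix, while the rules for
      scaling and permuting act on rows; hence the transposition.\<close>
    define M where "M = (\<chi> i j. \<phi> (log_derivation i (u j)))"
    have "ratfun.jacobian (\<lambda>i. \<phi> (u i)) = det (transpose (\<chi> i j. log_derivation i (\<phi> (u j))))"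
      unfolding ratfun.jacobian_def by (rule arg_cong[where f=det]) (simp add: vec_eq_iff transpose_def)
    also have "\<dots> = det (\<chi> i. of_nat (m i) *s M $ \<sigma> i)"
      unfolding det_transpose
      by (rule arg_cong[where f=det]) (simp add: vec_eq_iff M_def log ratfun_const_of_nat)
    also have "\<dots> = (\<Prod>i\<in>UNIV. of_nat (m i)) * det (\<chi> i. M $ \<sigma> i)"
      by (rule det_rows_mul)
    also have "\<dots> = (\<Prod>i\<in>UNIV. of_nat (m i)) * (of_int (sign \<sigma>) * det M)"
      by (simp add: det_permute_rows[OF \<sigma>])
    also have "det M = det (transpose (\<chi> i j. \<phi> (log_derivation j (u i))))"
      by (rule arg_cong[where f=det]) (simp add: vec_eq_iff M_def transpose_def)
    also have "\<dots> = \<phi> (ratfun.jacobian u)"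
      by (simp add: \<phi>.det ratfun.jacobian_def)
    finally show ?thesis
      unfolding ratfun_const_of_int by simp
  qed
  have \<phi>_scale: "\<phi> (ratfun_scale c x) = ratfun_scale c (\<phi> x)" for c x
    by (simp add: ratfun_scale_def \<phi>.mult const)
  interpret vector_space "ratfun_scale :: 'k \<Rightarrow> ('k, 'n) ratfun \<Rightarrow> _"
    by (rule vector_space_ratfun_scale)
  have linear: "Vector_Spaces.linear ratfun_scale ratfun_scale \<phi>"
    by unfold_locales (simp_all only: \<phi>.add \<phi>_scale)
  have bracket: "\<phi> (ratfun_const (q * z) * x) = ratfun_const q * (ratfun_const z * \<phi> x)" for z x
    by (simp only: \<phi>.mult const ratfun_const_mult mult.assoc)
  have "nambu_poisson_embedding ratfun_scale
      (skew_bracket (q * of_int (sign \<sigma> * (\<Prod>i\<in>UNIV. int (m i))))) ratfun_scale (skew_bracket q) \<phi>"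
    unfolding skew_bracket_eq
    by (intro nambu_poisson_embedding.intro nambu_poisson_embedding_axioms.intro
        nambu_poisson_algebra_jacobian linear \<phi>.one \<phi>.mult \<phi>.inj)
      (simp only: bracket jacobian)
  then show ?thesis
    by (intro exI[of _ \<phi>])
qed

lemma nambu_poisson_embedding_int_mult:
  fixes q :: "'k::field_char_0"
  assumes card: "CARD('n::{finite,linorder}) \<ge> 2" and "z \<noteq> 0"
  shows "\<exists>\<phi> :: ('k, 'n) ratfun \<Rightarrow> ('k, 'n) ratfun. nambu_poisson_embedding ratfun_scale
    (skew_bracket (q * of_int z)) ratfun_scale (skew_bracket q) \<phi>"
proof -
  obtain a b :: 'n where ab: "a \<noteq> b"
  proof -
    have "\<not> is_singleton (UNIV :: 'n set)"
      using card by (auto simp: is_singleton_altdef)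
    then show thesis
      by (metis is_singletonI' UNIV_I UNIV_not_empty that)
  qed
  \<comment> \<open>One variable carries the absolute value of \<open>z\<close>; the sign is left to
    the transposition of \<open>a\<close> and \<open>b\<close>, which exist as there are at least
    two indices.\<close>
  define m where "m i = (if i = a then nat \<bar>z\<bar> else 1)" for i :: 'n
  define \<sigma> where "\<sigma> = (if z > 0 then id else Transposition.transpose a b)"
  have "(\<Prod>i\<in>UNIV. int (m i)) = \<bar>z\<bar>"
    by (simp add: m_def if_distrib cong: if_cong)
  moreover have "sign \<sigma> * \<bar>z\<bar> = z"
    using \<open>z \<noteq> 0\<close> ab by (auto simp: \<sigma>_def sign_swap_id)
  moreover have "\<sigma> permutes UNIV" "m i \<noteq> 0" for i
    using \<open>z \<noteq> 0\<close> by (auto simp: \<sigma>_def m_def permutes_swap_id permutes_id)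
  ultimately show ?thesis
    using nambu_poisson_embedding_monomial[of m \<sigma> q] by simp
qed

section \<open>Leading terms and the residue map\<close>

lemma keys_mult_le:
  fixes e f :: "'a::{ordered_cancel_comm_monoid_add,linorder}"
  assumes "Poly_Mapping.keys p \<subseteq> {..e}" and "Poly_Mapping.keys q \<subseteq> {..f}"
  shows "Poly_Mapping.keys (p * q) \<subseteq> {..e + f}"
  using keys_mult[of p q] assms by (auto intro: add_mono)

text \<open>Addition is monotone and cancellative, so among exponents below the bounds only the pair
  (\<open>e\<close>, \<open>f\<close>) has sum \<open>e + f\<close>. The bounds need not be
  attained, which covers numerators with a smaller leading monomial, that is, residue 0.\<close>

lemma lookup_mult_top:
  fixes p q :: "'a::{ordered_cancel_comm_monoid_add,linorder} \<Rightarrow>\<^sub>0 'k::comm_semiring_0"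
  assumes p: "Poly_Mapping.keys p \<subseteq> {..e}" and q: "Poly_Mapping.keys q \<subseteq> {..f}"
  shows "Poly_Mapping.lookup (p * q) (e + f) = Poly_Mapping.lookup p e * Poly_Mapping.lookup q f"
proof -
  let ?l = Poly_Mapping.lookup
  have top: "x + y = e + f \<longleftrightarrow> x = e \<and> y = f" if "x \<le> e" "y \<le> f" for x y
  proof
    assume eq: "x + y = e + f"
    have "x + y \<le> e + y" "e + y \<le> e + f"
      using that by (auto intro: add_mono)
    then have "x + y = e + y"
      using eq by simp
    then have "x = e"
      by (rule add_right_imp_eq)
    with eq show "x = e \<and> y = f"
      by simp
  qed simp
  have "p * q = (\<Sum>x\<in>Poly_Mapping.keys p. \<Sum>y\<in>Poly_Mapping.keys q. Poly_Mapping.single (x + y) (?l p x * ?l q y))"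
    by (subst poly_mapping_sum_single[of p], subst poly_mapping_sum_single[of q])
      (simp add: sum_product mult_single)
  then have "?l (p * q) (e + f) =
      (\<Sum>x\<in>Poly_Mapping.keys p. \<Sum>y\<in>Poly_Mapping.keys q. if x = e \<and> y = f then ?l p x * ?l q y else 0)"
    using p q by (auto simp: lookup_sum lookup_single when_def top subset_iff intro!: sum.cong)
  also have "\<dots> = (\<Sum>x\<in>Poly_Mapping.keys p. if x = e then ?l p x * ?l q f else 0)"
  proof (intro sum.cong refl)
    fix x
    have "(\<Sum>y\<in>Poly_Mapping.keys q. if y = f then ?l p x * ?l q y else 0) = ?l p x * ?l q f"
      by (simp add: in_keys_iff)
    then show "(\<Sum>y\<in>Poly_Mapping.keys q. if x = e \<and> y = f then ?l p x * ?l q y else 0) =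
        (if x = e then ?l p x * ?l q f else 0)"
      by simp
  qed
  also have "\<dots> = ?l p e * ?l q f"
    by (simp add: in_keys_iff)
  finally show ?thesis .
qed

text \<open>A rational function with residue \<open>c\<close> lies in the valuation ring of the monomial order, and \<open>c\<close>
  is its image in the residue field.\<close>

definition has_residue :: "('k::field, 'n::{finite,linorder}) ratfun \<Rightarrow> 'k \<Rightarrow> bool" where
  "has_residue x c \<longleftrightarrow> (\<exists>a b e. x = Fract a b \<and> Poly_Mapping.keys a \<subseteq> {..e} \<and> Poly_Mapping.keys b \<subseteq> {..e} \<and>
     Poly_Mapping.lookup b e \<noteq> 0 \<and> Poly_Mapping.lookup a e = c * Poly_Mapping.lookup b e)"

lemma has_residueI:
  assumes "Poly_Mapping.keys a \<subseteq> {..e}" and "Poly_Mapping.keys b \<subseteq> {..e}"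
    and "Poly_Mapping.lookup b e \<noteq> 0" and "Poly_Mapping.lookup a e = c * Poly_Mapping.lookup b e"
  shows "has_residue (Fract a b) c"
  using assms unfolding has_residue_def by blast

lemma has_residue_add:
  assumes "has_residue x c" "has_residue y d"
  shows "has_residue (x + y) (c + d)"
proof -
  let ?l = Poly_Mapping.lookup and ?k = Poly_Mapping.keys
  obtain a b e where x: "x = Fract a b" "?k a \<subseteq> {..e}" "?k b \<subseteq> {..e}" "?l b e \<noteq> 0" "?l a e = c * ?l b e"
    using assms(1) unfolding has_residue_def by blast
  obtain a' b' e' where y: "y = Fract a' b'" "?k a' \<subseteq> {..e'}" "?k b' \<subseteq> {..e'}" "?l b' e' \<noteq> 0"
      "?l a' e' = d * ?l b' e'"
    using assms(2) unfolding has_residue_def by blast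
  have "b \<noteq> 0" "b' \<noteq> 0"
    using x y by auto
  then have "x + y = Fract (a * b' + a' * b) (b * b')"
    using x y by simp
  also have "has_residue \<dots> (c + d)"
  proof (rule has_residueI)
    show "?k (a * b' + a' * b) \<subseteq> {..e + e'}"
      using keys_add[of "a * b'" "a' * b"] keys_mult_le[OF x(2) y(3)]
        keys_mult_le[OF y(2) x(3), unfolded add.commute[of e']] by blast
    show "?k (b * b') \<subseteq> {..e + e'}"
      using x y by (simp add: keys_mult_le)
    show "?l (b * b') (e + e') \<noteq> 0"
      unfolding lookup_mult_top[OF x(3) y(3)] using x y by simp
    show "?l (a * b' + a' * b) (e + e') = (c + d) * ?l (b * b') (e + e')"
      unfolding lookup_add lookup_mult_top[OF x(2) y(3)] lookup_mult_top[OF x(3) y(3)]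
        lookup_mult_top[OF y(2) x(3), unfolded add.commute[of e']] x(5) y(5)
      by (simp add: algebra_simps)
  qed
  finally show ?thesis .
qed

lemma has_residue_mult:
  assumes "has_residue x c" "has_residue y d"
  shows "has_residue (x * y) (c * d)"
proof -
  let ?l = Poly_Mapping.lookup and ?k = Poly_Mapping.keys
  obtain a b e where x: "x = Fract a b" "?k a \<subseteq> {..e}" "?k b \<subseteq> {..e}" "?l b e \<noteq> 0" "?l a e = c * ?l b e"
    using assms(1) unfolding has_residue_def by blast
  obtain a' b' e' where y: "y = Fract a' b'" "?k a' \<subseteq> {..e'}" "?k b' \<subseteq> {..e'}" "?l b' e' \<noteq> 0"
      "?l a' e' = d * ?l b' e'"
    using assms(2) unfolding has_residue_def by blast
  have "has_residue (Fract (a * a') (b * b')) (c * d)"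
  proof (rule has_residueI)
    show "?k (a * a') \<subseteq> {..e + e'}" "?k (b * b') \<subseteq> {..e + e'}"
      using x y by (simp_all add: keys_mult_le)
    show "?l (b * b') (e + e') \<noteq> 0"
      unfolding lookup_mult_top[OF x(3) y(3)] using x y by simp
    show "?l (a * a') (e + e') = c * d * ?l (b * b') (e + e')"
      unfolding lookup_mult_top[OF x(2) y(2)] lookup_mult_top[OF x(3) y(3)] x(5) y(5)
      by (simp add: mult_ac)
  qed
  then show ?thesis
    using x y by simp
qed

lemma has_residue_const: "has_residue (ratfun_const c) c"
  unfolding has_residue_def ratfun_const_def
  by (intro exI[of _ "Poly_Mapping.single 0 c"] exI[of _ 1] exI[of _ 0]) auto

text \<open>If a / b represents the constant \<open>d\<close>, then a = d * b, and comparing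
  coefficients at \<open>e\<close> gives the residue.\<close>

lemma has_residue_const_unique:
  assumes "has_residue (ratfun_const d :: ('k::field, 'n::{finite,linorder}) ratfun) c"
  shows "c = d"
proof -
  let ?l = Poly_Mapping.lookup and ?k = Poly_Mapping.keys
  obtain a b e where x: "(ratfun_const d :: ('k, 'n) ratfun) = Fract a b" "?k b \<subseteq> {..e}" "?l b e \<noteq> 0" "?l a e = c * ?l b e"
    using assms unfolding has_residue_def by blast
  have "b \<noteq> 0"
    using x by auto
  then have "Poly_Mapping.single 0 d * b = a"
    using x by (simp add: ratfun_const_def eq_fract)
  moreover have "?l (Poly_Mapping.single 0 d * b) (0 + e) = d * ?l b e"
    using lookup_mult_top[of "Poly_Mapping.single 0 d" 0 b e] x by simp
  ultimately show ?thesis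
    using x by simp
qed

lemma has_residue_of_int: "has_residue (of_int z) (of_int z)"
  using has_residue_const[of "of_int z"] by (simp add: ratfun_const_of_int)

lemma has_residue_sum:
  assumes "\<And>i. i \<in> A \<Longrightarrow> has_residue (f i) (g i)"
  shows "has_residue (\<Sum>i\<in>A. f i) (\<Sum>i\<in>A. g i)"
  using assms
  by (induction A rule: infinite_finite_induct)
    (use has_residue_of_int[of 0] in \<open>auto intro!: has_residue_add\<close>)

lemma has_residue_prod:
  assumes "\<And>i. i \<in> A \<Longrightarrow> has_residue (f i) (g i)"
  shows "has_residue (\<Prod>i\<in>A. f i) (\<Prod>i\<in>A. g i)"
  using assms
  by (induction A rule: infinite_finite_induct)
    (use has_residue_of_int[of 1] in \<open>auto intro!: has_residue_mult\<close>)

text \<open>A determinant is a polynomial in the entries with integer coefficients, and residues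
  respect sums, products and integers.\<close>

lemma has_residue_det:
  assumes "\<And>i j. has_residue (M $ i $ j) (N $ i $ j)"
  shows "has_residue (det M) (det N)"
  unfolding det_def
  by (intro has_residue_sum has_residue_mult has_residue_prod has_residue_of_int assms)

section \<open>Integral residues of logarithmic derivatives and necessity of the condition\<close>

text \<open>\<open>euler i\<close> creates no new monomials and multiplies the leading coefficient
  by the \<open>i\<close>-th leading exponent. If that exponent is 0, the leading term disappears
  and the residue is 0, as required.\<close>

lemma has_residue_log_derivative_polynomial:
  fixes p :: "('k::field_char_0, 'n::{finite,linorder}) polynomial"
  assumes "p \<noteq> 0"
  obtains z :: "'n \<Rightarrow> nat" where "\<And>i. has_residue (Fract (euler i p) p) (of_nat (z i))"
proof -
  define e where "e = Max (Poly_Mapping.keys p)"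
  have "Poly_Mapping.keys p \<noteq> {}"
    using assms by simp
  then have e: "Poly_Mapping.lookup p e \<noteq> 0"
    unfolding e_def in_keys_iff[symmetric] by (intro Max_in finite_keys)
  have top: "Poly_Mapping.keys p \<subseteq> {..e}"
    by (auto simp: e_def)
  have euler: "Poly_Mapping.keys (euler i p) \<subseteq> {..e}" for i
    unfolding euler_def by (rule subset_trans[OF keys_mapp_subset top])
  have "has_residue (Fract (euler i p) p) (of_nat (Poly_Mapping.lookup e i))" for i
    by (rule has_residueI[OF euler top e lookup_euler])
  then show thesis
    by (rule that)
qed

lemma has_residue_log_derivative:
  fixes x :: "('k::field_char_0, 'n::{finite,linorder}) ratfun"
  assumes "x \<noteq> 0"
  obtains z :: "'n \<Rightarrow> int" where "\<And>i. has_residue (log_derivation i x / x) (of_int (z i))"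
proof -
  obtain a b where x: "x = Fract a b" and b: "b \<noteq> 0" and a: "a \<noteq> 0"
    using assms by (metis Fract_cases_nonzero)
  obtain za zb :: "'n \<Rightarrow> nat" where
    za: "\<And>i. has_residue (Fract (euler i a) a) (of_nat (za i))" and
    zb: "\<And>i. has_residue (Fract (euler i b) b) (of_nat (zb i))"
    using has_residue_log_derivative_polynomial[OF a] has_residue_log_derivative_polynomial[OF b] by metis
  \<comment> \<open>A logarithmic derivative turns a quotient into a difference. The difference is
    written with \<open>of_int (- 1)\<close> so that the rules for sums and products of residues
    apply.\<close>
  have "log_derivation i x / x = Fract (euler i a) a + of_int (- 1) * Fract (euler i b) b" for i
    using a b by (simp add: x log_derivation_def fract_derivation_Fract[OF derivation_euler] eq_fract)
  then have "has_residue (log_derivation i x / x) (of_int (int (za i) - int (zb i)))" for i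
    using has_residue_add[OF za has_residue_mult[OF has_residue_of_int[of "- 1"] zb], of i i] by simp
  then show thesis
    by (rule that)
qed

lemma of_int_det: "of_int (det M) = det (\<chi> i j. of_int (M $ i $ j))"
  by (simp add: det_def)

lemma nambu_poisson_embedding_imp_int:
  fixes q q' :: "'k::field_char_0" and \<phi> :: "('k, 'n::{finite,linorder}) ratfun \<Rightarrow> ('k, 'n) ratfun"
  assumes "nambu_poisson_embedding ratfun_scale (skew_bracket q) ratfun_scale (skew_bracket q') \<phi>"
    and "q' \<noteq> 0"
  shows "q / q' \<in> \<int>"
proof -
  interpret nambu_poisson_embedding ratfun_scale "skew_bracket q" ratfun_scale "skew_bracket q'" \<phi>
    by fact
  interpret \<phi>: idom_embedding \<phi>
    by standard (simp_all add: add map_mult map_one injective)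
  define f where "f = (\<lambda>i. \<phi> (ratfun_var i))"
  have f: "f i \<noteq> 0" for i
    by (simp add: f_def)
  have "\<phi> (ratfun_const c) = ratfun_const c" for c
    using scale[of c 1] by (simp add: ratfun_scale_def map_one)
  \<comment> \<open>Preservation of the bracket is used on the variables alone; constants are fixed
    because \<phi> is linear and preserves 1.\<close>
  then have *: "ratfun_const q * (\<Prod>i\<in>UNIV. f i) = ratfun_const q' * ratfun.jacobian f"
    using map_bracket[of ratfun_var]
    by (simp add: skew_bracket_eq jacobian_ratfun_var map_mult \<phi>.prod f_def)
  \<comment> \<open>Dividing row \<open>i\<close> by \<open>f i\<close> cancels the product of the
    \<open>f i\<close> on the other side and leaves a constant determinant.\<close>
  define L where "L = (\<chi> i j. log_derivation j (f i) / f i)"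
  have "ratfun.jacobian f = det (\<chi> i. f i *s L $ i)"
    unfolding ratfun.jacobian_def
    by (rule arg_cong[where f=det]) (simp add: vec_eq_iff L_def f)
  also have "\<dots> = (\<Prod>i\<in>UNIV. f i) * det L"
    by (simp add: det_rows_mul)
  finally have "ratfun_const q = ratfun_const q' * det L"
    using * f by simp
  moreover have "ratfun_const q = (ratfun_const q' * ratfun_const (q / q') :: ('k, 'n) ratfun)"
    using \<open>q' \<noteq> 0\<close> by (simp add: ratfun_const_mult[symmetric])
  moreover have "ratfun_const q' \<noteq> (0 :: ('k, 'n) ratfun)"
    using \<open>q' \<noteq> 0\<close> ratfun_const_eq_iff[of q' 0] by (simp add: ratfun_const_0)
  ultimately have L: "det L = ratfun_const (q / q')"
    by simp
  have "\<exists>z :: 'n \<Rightarrow> int. \<forall>j. has_residue (log_derivation j (f i) / f i) (of_int (z j))" for i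
    using has_residue_log_derivative[OF f[of i]] by metis
  then obtain Z :: "'n \<Rightarrow> 'n \<Rightarrow> int" where
    Z: "\<And>i j. has_residue (log_derivation j (f i) / f i) (of_int (Z i j))"
    by metis
  have "has_residue (det L) (det (\<chi> i j. of_int (Z i j)))"
    by (rule has_residue_det) (simp add: L_def Z)
  then have "q / q' = det (\<chi> i j. of_int (Z i j))"
    unfolding L by (rule has_residue_const_unique[symmetric])
  also have "\<dots> = of_int (det (\<chi> i j. Z i j))"
    by (simp add: of_int_det)
  finally show ?thesis
    by simp
qed

theorem theorem4p16:
  fixes q q' :: "'k::field_char_0"
  assumes "CARD('n::{finite,linorder}) \<ge> 2" and "q \<noteq> 0" and "q' \<noteq> 0"
  shows "(\<exists>\<phi> :: ('k, 'n) ratfun \<Rightarrow> ('k, 'n) ratfun.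
            nambu_poisson_embedding ratfun_scale (skew_bracket q)
              ratfun_scale (skew_bracket q') \<phi>)
         \<longleftrightarrow> q / q' \<in> \<int>"
proof
  assume "\<exists>\<phi> :: ('k, 'n) ratfun \<Rightarrow> ('k, 'n) ratfun.
      nambu_poisson_embedding ratfun_scale (skew_bracket q) ratfun_scale (skew_bracket q') \<phi>"
  then show "q / q' \<in> \<int>"
    using nambu_poisson_embedding_imp_int[OF _ \<open>q' \<noteq> 0\<close>] by blast
next
  assume "q / q' \<in> \<int>"
  then obtain z where "q / q' = of_int z"
    by (rule Ints_cases)
  then have q: "q = q' * of_int z"
    using \<open>q' \<noteq> 0\<close> by (simp add: field_simps)
  then have "z \<noteq> 0"
    using \<open>q \<noteq> 0\<close> by auto
  then show "\<exists>\<phi> :: ('k, 'n) ratfun \<Rightarrow> ('k, 'n) ratfun.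
      nambu_poisson_embedding ratfun_scale (skew_bracket q) ratfun_scale (skew_bracket q') \<phi>"
    unfolding q by (rule nambu_poisson_embedding_int_mult[OF assms(1)])
qed

end
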